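(* Let $a,b,c,k,l,m$ be positive integers with $c\mid ab$ and $k,l\ge m$, let $i\in\{1,2\}$, and let $d=d_i^{\pm}=a^{2k}b^{2l}\pm i c^m$ (for a fixed choice of sign) be a square-free positive integer. Let $(x_1,y_1)$ be the fundamental solution of $x^2-dy^2=1$. Then all positive integer solutions of $x^2-dy^2=1$ are given by $$(x_n,y_n)=\Big(\tfrac12 L_n(2x_1,-1),\; y_1 f_n(2x_1,-1)\Big),\qquad n=1,2,3,\dots$$
   Context: The fundamental solution of $x^2-dy^2=1$ is the solution in positive integers with least positive values. For nonzero integers $w,z$ with $w^2+4z\ge0$, the generalized Fibonacci and Lucas sequences are defined by $f_0(w,z)=0$, $f_1(w,z)=1$, $f_n(w,z)=wf_{n-1}(w,z)+zf_{n-2}(w,z)$ and $L_0(w,z)=2$, $L_1(w,z)=w$, $L_n(w,z)=wL_{n-1}(w,z)+zL_{n-2}(w,z)$ for $n\ge2$. *)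

theory Defs
  imports Complex_Main "HOL-Computational_Algebra.Squarefree"
begin

definition pell_pos_solution :: "int \<Rightarrow> int \<Rightarrow> int \<Rightarrow> bool" where
  "pell_pos_solution d x y \<longleftrightarrow> 0 < x \<and> 0 < y \<and> x\<^sup>2 - d * y\<^sup>2 = 1"

definition pell_fundamental_solution :: "int \<Rightarrow> int \<Rightarrow> int \<Rightarrow> bool" where
  "pell_fundamental_solution d x y \<longleftrightarrow>
     pell_pos_solution d x y \<and> (\<forall>u v. pell_pos_solution d u v \<longrightarrow> x \<le> u \<and> y \<le> v)"

(* The sequences are meant for nonzero w, z with w^2 + 4z >= 0; the recursions make sense
   for all integers, so the definitions are total. *)

fun gen_fib :: "int \<Rightarrow> int \<Rightarrow> nat \<Rightarrow> int" where
  "gen_fib w z 0 = 0"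
| "gen_fib w z (Suc 0) = 1"
| "gen_fib w z (Suc (Suc n)) = w * gen_fib w z (Suc n) + z * gen_fib w z n"

fun gen_lucas :: "int \<Rightarrow> int \<Rightarrow> nat \<Rightarrow> int" where
  "gen_lucas w z 0 = 2"
| "gen_lucas w z (Suc 0) = w"
| "gen_lucas w z (Suc (Suc n)) = w * gen_lucas w z (Suc n) + z * gen_lucas w z n"

end

theory Submission
  imports Defs
begin

text \<open>
  The step \<open>n \<mapsto> n + 1\<close> of the Lucas and Fibonacci sequences with parameters \<open>(2 x\<^sub>1, -1)\<close> is
  multiplication by \<open>x\<^sub>1 + y\<^sub>1 \<surd>d\<close>, so every \<open>n \<ge> 1\<close> yields a solution. Conversely, multiplying
  a solution other than the fundamental one by the conjugate \<open>x\<^sub>1 - y\<^sub>1 \<surd>d\<close> yields a positive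
  solution with smaller second component, so Fermat descent reaches \<open>(x\<^sub>1, y\<^sub>1)\<close>.
\<close>

text \<open>The number \<open>x + sqrt (x\<^sup>2 - 1)\<close> has trace \<open>2 * x\<close> and
  norm 1, so its powers obey the second-order recurrence; these first-order rules describe
  multiplication by it. They are proved jointly because each induction step uses both.\<close>

lemma gen_lucas_gen_fib_Suc:
  "gen_lucas (2 * x) (-1) (Suc n) = x * gen_lucas (2 * x) (-1) n + 2 * (x\<^sup>2 - 1) * gen_fib (2 * x) (-1) n \<and>
   2 * gen_fib (2 * x) (-1) (Suc n) = gen_lucas (2 * x) (-1) n + 2 * x * gen_fib (2 * x) (-1) n"
proof (induction n)
  case 0
  then show ?case by simp
next
  case (Suc n)
  let ?L = "gen_lucas (2 * x) (-1)" and ?f = "gen_fib (2 * x) (-1)"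
  have L: "?L (Suc n) = x * ?L n + 2 * (x\<^sup>2 - 1) * ?f n"
    and f: "2 * ?f (Suc n) = ?L n + 2 * x * ?f n"
    using Suc.IH by auto
  have "?L (Suc (Suc n)) = 2 * x * ?L (Suc n) - ?L n"
    by simp
  \<comment> \<open>One of the two summands \<open>x * ?L (Suc n)\<close> is kept; the induction
    hypothesis rewrites the rest as a multiple of \<open>?f (Suc n)\<close>.\<close>
  moreover have "x * ?L (Suc n) - ?L n = (x\<^sup>2 - 1) * (2 * ?f (Suc n))"
    unfolding L f by (simp add: algebra_simps power2_eq_square)
  ultimately have "?L (Suc (Suc n)) = x * ?L (Suc n) + 2 * (x\<^sup>2 - 1) * ?f (Suc n)"
    by (simp add: algebra_simps)
  moreover have "2 * ?f (Suc (Suc n)) = 2 * x * (2 * ?f (Suc n)) - 2 * ?f n"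
    by simp
  moreover have "x * (2 * ?f (Suc n)) - 2 * ?f n = ?L (Suc n)"
    unfolding L f by (simp add: algebra_simps power2_eq_square)
  ultimately show ?case
    by (simp add: algebra_simps)
qed

lemmas gen_lucas_Suc = gen_lucas_gen_fib_Suc[THEN conjunct1]
  and gen_fib_Suc = gen_lucas_gen_fib_Suc[THEN conjunct2]

text \<open>Brahmagupta's identity: the norm of \<open>x + y * sqrt d\<close> is
  multiplicative.\<close>

lemma pell_pos_solution_mult:
  assumes "0 < d" "pell_pos_solution d x1 y1" "pell_pos_solution d x y"
  shows "pell_pos_solution d (x1 * x + d * y1 * y) (y1 * x + x1 * y)"
proof -
  have "(x1 * x + d * y1 * y)\<^sup>2 - d * (y1 * x + x1 * y)\<^sup>2 = (x1\<^sup>2 - d * y1\<^sup>2) * (x\<^sup>2 - d * y\<^sup>2)"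
    by (simp add: algebra_simps power2_eq_square)
  then show ?thesis
    using assms unfolding pell_pos_solution_def by (simp add: add_pos_pos)
qed

text \<open>Multiplication by the conjugate preserves norm 1. Each of the three inequalities is
  obtained by comparing squares, after eliminating \<open>x1\<^sup>2\<close> and
  \<open>x\<^sup>2\<close> by the Pell equation.\<close>

lemma pell_pos_solution_descent:
  assumes "0 < d" "pell_pos_solution d x1 y1" "pell_pos_solution d x y" "y1 < y"
  shows "pell_pos_solution d (x1 * x - d * y1 * y) (x1 * y - y1 * x)"
    and "x1 * y - y1 * x < y"
proof -
  have pos: "0 < x1" "0 < y1" "0 < x" "0 < y" and e1: "x1\<^sup>2 = 1 + d * y1\<^sup>2" and e: "x\<^sup>2 = 1 + d * y\<^sup>2"
    using assms unfolding pell_pos_solution_def by (auto simp: algebra_simps)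
  have "(x1 * x)\<^sup>2 - (d * y1 * y)\<^sup>2 = 1 + d * y1\<^sup>2 + d * y\<^sup>2"
    unfolding power_mult_distrib e1 e by (simp add: algebra_simps power2_eq_square)
  also have "\<dots> > 0"
    using assms(1) by (simp add: add_pos_nonneg)
  finally have "(d * y1 * y)\<^sup>2 < (x1 * x)\<^sup>2"
    by linarith
  then have 1: "d * y1 * y < x1 * x"
    by (rule power2_less_imp_less) (use pos in simp)
  have "(x1 * y)\<^sup>2 - (y1 * x)\<^sup>2 = y\<^sup>2 - y1\<^sup>2"
    unfolding power_mult_distrib e1 e by (simp add: algebra_simps power2_eq_square)
  also have "\<dots> > 0"
    using pos assms(4) by (simp add: power_strict_mono)
  finally have "(y1 * x)\<^sup>2 < (x1 * y)\<^sup>2"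
    by linarith
  then have 2: "y1 * x < x1 * y"
    by (rule power2_less_imp_less) (use pos in simp)
  have "(x1 * x - d * y1 * y)\<^sup>2 - d * (x1 * y - y1 * x)\<^sup>2 = (x1\<^sup>2 - d * y1\<^sup>2) * (x\<^sup>2 - d * y\<^sup>2)"
    by (simp add: algebra_simps power2_eq_square)
  then show "pell_pos_solution d (x1 * x - d * y1 * y) (x1 * y - y1 * x)"
    using 1 2 e1 e unfolding pell_pos_solution_def by simp
  \<comment> \<open>The claim \<open>x1 * y - y1 * x < y\<close> amounts to
    \<open>(x1 - 1) * y < y1 * x\<close>, with both sides nonnegative because
    \<open>x1 \<ge> 1\<close>.\<close>
  have "(y1 * x)\<^sup>2 - ((x1 - 1) * y)\<^sup>2 = y1\<^sup>2 + 2 * (x1 - 1) * y\<^sup>2"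
  proof -
    have "((x1 - 1) * y)\<^sup>2 = (x1\<^sup>2 - 2 * x1 + 1) * y\<^sup>2"
      by (simp add: algebra_simps power2_eq_square)
    then show ?thesis
      unfolding power_mult_distrib e1 e by (simp add: algebra_simps)
  qed
  also have "\<dots> > 0"
    using pos by (intro add_pos_nonneg) auto
  finally have "((x1 - 1) * y)\<^sup>2 < (y1 * x)\<^sup>2"
    by linarith
  then have "(x1 - 1) * y < y1 * x"
    by (rule power2_less_imp_less) (use pos in simp)
  then show "x1 * y - y1 * x < y"
    by (simp add: algebra_simps)
qed

text \<open>The witness \<open>x\<close> records that the Lucas number is even. Indices start at
  \<open>Suc n\<close> because index 0 gives the trivial solution (1, 0), which is not
  positive.\<close>

lemma gen_lucas_gen_fib_pell_pos_solution:
  assumes "0 < d" "pell_pos_solution d x1 y1"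
  shows "\<exists>x. gen_lucas (2 * x1) (-1) (Suc n) = 2 * x \<and>
             pell_pos_solution d x (y1 * gen_fib (2 * x1) (-1) (Suc n))"
proof (induction n)
  case 0
  then show ?case using assms by simp
next
  case (Suc n)
  let ?L = "gen_lucas (2 * x1) (-1)" and ?f = "gen_fib (2 * x1) (-1)"
  obtain x where x: "?L (Suc n) = 2 * x" "pell_pos_solution d x (y1 * ?f (Suc n))"
    using Suc.IH by blast
  have e1: "x1\<^sup>2 - 1 = d * y1\<^sup>2"
    using assms(2) unfolding pell_pos_solution_def by simp
  have "?L (Suc (Suc n)) = 2 * (x1 * x + d * y1 * (y1 * ?f (Suc n)))"
    unfolding gen_lucas_Suc[of x1 "Suc n"] x(1) e1 by (simp add: algebra_simps power2_eq_square)
  \<comment> \<open>Evenness of \<open>?L (Suc n)\<close> lets the factor 2 in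
    \<open>gen_fib_Suc\<close> cancel.\<close>
  moreover have "?f (Suc (Suc n)) = x + x1 * ?f (Suc n)"
    using gen_fib_Suc[of x1 "Suc n"] x(1) by linarith
  then have "y1 * ?f (Suc (Suc n)) = y1 * x + x1 * (y1 * ?f (Suc n))"
    by (simp only: distrib_left mult.left_commute)
  ultimately show ?case
    using pell_pos_solution_mult[OF assms x(2)] by metis
qed

lemma pell_pos_solution_imp_gen_lucas_gen_fib:
  assumes "0 < d" "pell_fundamental_solution d x1 y1" "pell_pos_solution d x y"
  shows "\<exists>n\<ge>1. 2 * x = gen_lucas (2 * x1) (-1) n \<and> y = y1 * gen_fib (2 * x1) (-1) n"
  using assms(3)
proof (induction "nat y" arbitrary: x y rule: less_induct)
  case less
  let ?L = "gen_lucas (2 * x1) (-1)" and ?f = "gen_fib (2 * x1) (-1)"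
  have sol1: "pell_pos_solution d x1 y1" and "y1 \<le> y"
    using assms(2) less.prems unfolding pell_fundamental_solution_def by auto
  have e1: "x1\<^sup>2 - d * y1\<^sup>2 = 1"
    using sol1 unfolding pell_pos_solution_def by simp
  show ?case
  proof (cases "y = y1")
    case True
    then have "x\<^sup>2 = x1\<^sup>2" "0 < x" "0 < x1"
      using less.prems sol1 unfolding pell_pos_solution_def by (simp_all add: algebra_simps)
    then have "x = x1"
      by (simp add: power2_eq_iff)
    with True show ?thesis
      by (intro exI[of _ 1]) simp
  next
    case False
    with \<open>y1 \<le> y\<close> have "y1 < y" by simp
    let ?x = "x1 * x - d * y1 * y" and ?y = "x1 * y - y1 * x"
    note descent = pell_pos_solution_descent[OF assms(1) sol1 less.prems \<open>y1 < y\<close>]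
    have "nat ?y < nat y"
      using descent less.prems unfolding pell_pos_solution_def by simp
    then obtain n where n: "2 * ?x = ?L n" "?y = y1 * ?f n"
      using less.hyps descent(1) by blast
    \<comment> \<open>Since \<open>x1 + y1 * sqrt d\<close> has norm 1, multiplying the smaller
      solution by it recovers \<open>(x, y)\<close> and raises the index from \<open>n\<close> to
      \<open>Suc n\<close>. Everything is doubled to match \<open>?L\<close>.\<close>
    have "x1 * (2 * ?x) + 2 * d * y1 * ?y = 2 * x * (x1\<^sup>2 - d * y1\<^sup>2)"
      by (simp add: algebra_simps power2_eq_square)
    then have "2 * x = x1 * ?L n + 2 * d * y1 * (y1 * ?f n)"
      using e1 n by simp
    also have "\<dots> = x1 * ?L n + 2 * (d * y1\<^sup>2) * ?f n"
      by (simp add: power2_eq_square)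
    also have "\<dots> = ?L (Suc n)"
      using e1 gen_lucas_Suc[of x1 n] by (simp add: algebra_simps)
    finally have X: "2 * x = ?L (Suc n)" .
    have "y1 * (2 * ?x) + 2 * x1 * ?y = 2 * y * (x1\<^sup>2 - d * y1\<^sup>2)"
      by (simp add: algebra_simps power2_eq_square)
    then have "2 * y = y1 * ?L n + 2 * x1 * (y1 * ?f n)"
      using e1 n by simp
    also have "\<dots> = y1 * (2 * ?f (Suc n))"
      unfolding gen_fib_Suc by (simp add: algebra_simps)
    finally have "y = y1 * ?f (Suc n)" by simp
    with X show ?thesis
      by (intro exI[of _ "Suc n"]) simp
  qed
qed

theorem theorem4p7:
  fixes a b c d i s x1 y1 :: int and k l m :: nat
  assumes "0 < a" and "0 < b" and "0 < c"
    and "0 < k" and "0 < l" and "0 < m"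
    and "c dvd a * b"
    and "m \<le> k" and "m \<le> l"
    and "i \<in> {1, 2}" and "s \<in> {1, -1}"
    and "d = a ^ (2 * k) * b ^ (2 * l) + s * (i * c ^ m)"
    and "0 < d" and "squarefree d"
    and "pell_fundamental_solution d x1 y1"
  shows "{(real_of_int x, real_of_int y) | x y. pell_pos_solution d x y} =
         {(1 / 2 * real_of_int (gen_lucas (2 * x1) (-1) n),
           real_of_int (y1 * gen_fib (2 * x1) (-1) n)) | n. 1 \<le> n}"
    (is "?S = ?T")
proof (intro equalityI subsetI)
  fix p assume "p \<in> ?S"
  then obtain x y where p: "p = (real_of_int x, real_of_int y)" "pell_pos_solution d x y"
    by blast
  obtain n where n: "1 \<le> n" "2 * x = gen_lucas (2 * x1) (-1) n" "y = y1 * gen_fib (2 * x1) (-1) n"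
    using pell_pos_solution_imp_gen_lucas_gen_fib[OF assms(13,15) p(2)] by blast
  \<comment> \<open>Halving takes place in the reals, as in the statement.\<close>
  have "real_of_int x = 1 / 2 * real_of_int (gen_lucas (2 * x1) (-1) n)"
    unfolding n(2)[symmetric] by simp
  with p(1) n(1,3) show "p \<in> ?T"
    by blast
next
  fix p assume "p \<in> ?T"
  then obtain n where n: "1 \<le> n" and p: "p = (1 / 2 * real_of_int (gen_lucas (2 * x1) (-1) n),
      real_of_int (y1 * gen_fib (2 * x1) (-1) n))"
    by blast
  obtain n' where n': "n = Suc n'"
    using n by (cases n) auto
  have "pell_pos_solution d x1 y1"
    using assms(15) unfolding pell_fundamental_solution_def by blast
  then obtain x where x: "gen_lucas (2 * x1) (-1) n = 2 * x"
      "pell_pos_solution d x (y1 * gen_fib (2 * x1) (-1) n)"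
    using gen_lucas_gen_fib_pell_pos_solution[OF assms(13)] unfolding n' by blast
  have "p = (real_of_int x, real_of_int (y1 * gen_fib (2 * x1) (-1) n))"
    unfolding p x(1) by simp
  with x(2) show "p \<in> ?S"
    by blast
qed

end
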